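(* Let $E \subseteq \mathbb{R}^2$ be a $1$-separated set (any two distinct points of $E$ are at distance at least $1$). For $u > 0$ and $v \in \mathbb{R}$ let \[t_{u,v} = \left\{(x,y) \in \mathbb{R}^2 \;:\; -\tfrac{1}{u}x + v\sqrt{1+\tfrac{1}{u^2}} < y \leq -\tfrac{1}{u}x + (v+1)\sqrt{1+\tfrac{1}{u^2}}\right\},\] a tube of width $1$ perpendicular to lines of slope $u$, displaced by $v$ along the line through the origin of slope $u$. Then for Lebesgue-almost every $(u,v) \in (0,\infty) \times \mathbb{R}$, \[\overline{D}(E \cap t_{u,v}) \leq \max\big(0, \overline{D}(E) - 1\big).\]
   Context: For a $1$-separated set $F \subseteq \mathbb{R}^2$, the mass dimension is $\overline{D}(F) = \limsup_{l\to\infty} \frac{\log |F \cap [-l,l]^2|}{\log (2l)}$, where $|\cdot|$ denotes cardinality and $\log 0 = -\infty$. *)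

theory Defs
  imports "HOL-Analysis.Analysis"
begin

definition one_separated :: "(real \<times> real) set \<Rightarrow> bool" where
  "one_separated F \<longleftrightarrow> pairwise (\<lambda>p q. dist p q \<ge> 1) F"

text \<open>The logarithm of the cardinality, with \<open>log 0 = -\<infinity>\<close>. It is only meaningful for finite sets,
  which covers bounded 1-separated sets.\<close>

definition log_card :: "'a set \<Rightarrow> ereal" where
  "log_card A = (if card A = 0 then -\<infinity> else ereal (ln (real (card A))))"

definition mass_dim :: "(real \<times> real) set \<Rightarrow> ereal" where
  "mass_dim F =
     Limsup at_top (\<lambda>l::real. log_card (F \<inter> ({-l..l} \<times> {-l..l})) / ereal (ln (2 * l)))"

definition tube :: "real \<Rightarrow> real \<Rightarrow> (real \<times> real) set" where
  "tube u v = {(x, y). - (1 / u) * x + v * sqrt (1 + 1 / u\<^sup>2) < y \<and>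
                       y \<le> - (1 / u) * x + (v + 1) * sqrt (1 + 1 / u\<^sup>2)}"

end

theory Submission
  imports Defs
begin

text \<open>For a point \<open>p\<close> with sup norm \<open>r\<close>, the parameters \<open>(u, v)\<close> in a fixed bounded region whose
  tube contains \<open>p\<close> have measure \<open>O(1 / (1 + r))\<close>. If \<open>a \<ge> 0\<close> and \<open>mass_dim E < 1 + a\<close>, a dyadic
  count shows that the sum of \<open>(1 + r) powr - (1 + a)\<close> over \<open>E\<close> is finite. By Tonelli, the sum of
  \<open>(1 + r) powr - a\<close> over \<open>E \<inter> tube u v\<close> is then finite for almost every \<open>(u, v)\<close>, which forces
  \<open>mass_dim (E \<inter> tube u v) \<le> a\<close>. Finally \<open>a\<close> decreases to \<open>max 0 (mass_dim E - 1)\<close> along a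
  sequence.\<close>

section \<open>Finiteness and countability of 1-separated sets\<close>

lemma finite_one_separated_bounded:
  assumes "one_separated E" "bounded B"
  shows "finite (E \<inter> B)"
proof -
  have "uniform_discrete (E \<inter> B)"
    using assms(1) unfolding one_separated_def uniform_discrete_def pairwise_def
    by (intro exI[of _ 1]) force
  then show ?thesis
    using assms(2) uniform_discrete_finite_iff[of "E \<inter> B"] bounded_Int by blast
qed

abbreviation square :: "real \<Rightarrow> (real \<times> real) set" where
  "square l \<equiv> {-l..l} \<times> {-l..l}"

lemma finite_one_separated_square:
  "one_separated E \<Longrightarrow> finite (E \<inter> square l)"
  by (rule finite_one_separated_bounded) (auto intro: bounded_Times)

text \<open>Countability makes counting measure on \<open>E\<close> sigma-finite, which the later
  exchange of sum and integral relies on.\<close>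

lemma countable_one_separated:
  assumes "one_separated E"
  shows "countable E"
proof -
  have "E = (\<Union>n::nat. E \<inter> square (real n))"
  proof (intro equalityI subsetI)
    fix p assume "p \<in> E"
    obtain n where "max \<bar>fst p\<bar> \<bar>snd p\<bar> \<le> real n" using real_arch_simple by blast
    then have "p \<in> square (real n)" by (cases p) (auto simp: abs_le_iff)
    then show "p \<in> (\<Union>n::nat. E \<inter> square (real n))" using \<open>p \<in> E\<close> by blast
  qed auto
  also have "countable \<dots>"
    by (intro countable_UN) (auto intro: countable_finite finite_one_separated_square[OF assms])
  finally show ?thesis .
qed

section \<open>Mass dimension and weighted sums\<close>

definition supnorm :: "real \<times> real \<Rightarrow> real" where
  "supnorm p = max \<bar>fst p\<bar> \<bar>snd p\<bar>"

lemma supnorm_nonneg: "0 \<le> supnorm p"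
  by (simp add: supnorm_def)

lemma mem_square_iff: "p \<in> square l \<longleftrightarrow> supnorm p \<le> l"
  by (cases p) (auto simp: supnorm_def abs_le_iff)

text \<open>The strict bound on the upper limit gives a count of at most
  \<open>(2 * l) powr b\<close> beyond some threshold \<open>L\<close>. Below \<open>L\<close> the
  count is at most the one at \<open>L\<close>, and \<open>l powr b\<close> is at least 1 because
  \<open>b\<close> is nonnegative. \<open>C\<close> adds the two constants.\<close>

lemma card_square_le_of_mass_dim_less:
  assumes E: "one_separated E" and d: "mass_dim E < ereal b" and b: "0 \<le> b"
  obtains C where "0 \<le> C" "\<And>l. 1 \<le> l \<Longrightarrow> real (card (E \<inter> square l)) \<le> C * l powr b"
proof -
  from Limsup_lessD[OF d[unfolded mass_dim_def]]
  obtain L where L: "\<And>l. L \<le> l \<Longrightarrow> log_card (E \<inter> square l) / ereal (ln (2 * l)) < ereal b"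
    by (auto simp: eventually_at_top_linorder)
  define C where "C = 2 powr b + real (card (E \<inter> square L))"
  have "real (card (E \<inter> square l)) \<le> C * l powr b" if l: "1 \<le> l" for l
  proof (cases "L \<le> l")
    case True
    let ?N = "card (E \<inter> square l)"
    have "real ?N \<le> (2 * l) powr b"
    proof (cases "?N = 0")
      case False
      have "ln (2 * l) > 0" using l by simp
      moreover have "ereal (ln (real ?N)) / ereal (ln (2 * l)) < ereal b"
        using L[OF True] False by (simp add: log_card_def)
      ultimately have "ln (real ?N) \<le> b * ln (2 * l)"
        by (simp add: divide_simps split: if_splits)
      then have "exp (ln (real ?N)) \<le> exp (b * ln (2 * l))" by (subst exp_le_cancel_iff)
      then show ?thesis using False l by (simp add: powr_def)
    qed auto
    also have "\<dots> = 2 powr b * l powr b" using l by (simp add: powr_mult)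
    also have "\<dots> \<le> C * l powr b" by (intro mult_right_mono) (auto simp: C_def)
    finally show ?thesis .
  next
    case False
    have "card (E \<inter> square l) \<le> card (E \<inter> square L)"
      using False by (intro card_mono finite_one_separated_square E) auto
    then have "real (card (E \<inter> square l)) \<le> C * 1" by (simp add: C_def add_increasing)
    also have "\<dots> \<le> C * l powr b"
      using l b by (intro mult_left_mono ge_one_powr_ge_zero) (auto simp: C_def)
    finally show ?thesis .
  qed
  then show ?thesis using that[of C] by (auto simp: C_def)
qed

text \<open>Split the points dyadically by norm: at scale \<open>2 ^ k\<close> there are at most
  \<open>C * (2 ^ k) powr b\<close> points, each of weight at most \<open>w k\<close>. The totals
  form a geometric series of ratio \<open>2 powr (b - s) < 1\<close>.\<close>

lemma nn_integral_weight_finite: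
  assumes E: "one_separated E" and d: "mass_dim E < ereal b" and b: "0 \<le> b" and s: "b < s"
  shows "(\<integral>\<^sup>+p. ennreal ((1 + supnorm p) powr - s) \<partial>count_space E) < \<infinity>"
proof -
  obtain C where C: "0 \<le> C" "\<And>l. 1 \<le> l \<Longrightarrow> real (card (E \<inter> square l)) \<le> C * l powr b"
    using card_square_le_of_mass_dim_less[OF E d b] by metis
  \<comment> \<open>This is \<open>(2 ^ k / 2) powr - s\<close>, the largest weight possible once
    \<open>1 + supnorm p\<close> is at least half of \<open>2 ^ k\<close>.\<close>
  define w where "w k = 2 powr s * (2 ^ k) powr - s" for k :: nat
  have w: "0 \<le> w k" for k by (simp add: w_def)
  \<comment> \<open>Full squares replace dyadic annuli, so a point may count in many terms; an upper
    bound is all that is wanted, and one well-chosen term suffices.\<close>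
  have pointwise: "ennreal ((1 + supnorm p) powr - s) \<le> (\<Sum>k. ennreal (w k) * indicator (square (2 ^ k)) p)" for p
  proof -
    \<comment> \<open>The least natural number with \<open>1 + supnorm p \<le> 2 ^ k\<close>;
      minimality costs only the factor 2 in \<open>hi\<close>.\<close>
    define k where "k = nat \<lceil>log 2 (1 + supnorm p)\<rceil>"
    have r: "0 < 1 + supnorm p" "0 \<le> log 2 (1 + supnorm p)" using supnorm_nonneg[of p] by auto
    then have k: "log 2 (1 + supnorm p) \<le> real k" "real k \<le> 1 + log 2 (1 + supnorm p)"
      unfolding k_def by linarith+
    have lo: "1 + supnorm p \<le> 2 ^ k"
      using k(1) r by (simp add: log_le_iff powr_realpow)
    have "2 powr real k \<le> 2 powr (1 + log 2 (1 + supnorm p))" using k(2) by simp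
    then have hi: "2 ^ k \<le> 2 * (1 + supnorm p)" using r by (simp add: powr_add powr_realpow)
    have "(1 + supnorm p) powr - s \<le> (2 ^ k / 2) powr - s"
      using hi s b by (intro powr_mono2') auto
    also have "\<dots> = w k" by (simp add: w_def powr_divide powr_minus field_simps)
    finally have "ennreal ((1 + supnorm p) powr - s) \<le> ennreal (w k) * indicator (square (2 ^ k)) p"
      using lo by (auto simp: indicator_def mem_square_iff[of p] ennreal_leI)
    also have "\<dots> \<le> (\<Sum>k. ennreal (w k) * indicator (square (2 ^ k)) p)"
      using sum_le_suminf[of "\<lambda>k. ennreal (w k) * indicator (square (2 ^ k)) p" "{k}"]
      by (simp del: sum_mult_indicator)
    finally show ?thesis .
  qed
  have term_le: "(\<integral>\<^sup>+p. ennreal (w k) * indicator (square (2 ^ k)) p \<partial>count_space E)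
      \<le> ennreal (2 powr s * C * (2 powr (b - s)) ^ k)" for k
  proof -
    have eq: "((2::real) ^ k) powr b * (2 ^ k) powr - s = (2 powr (b - s)) ^ k"
      by (simp add: powr_add[symmetric] powr_realpow[symmetric] powr_powr algebra_simps)
    have "(\<integral>\<^sup>+p. ennreal (w k) * indicator (square (2 ^ k)) p \<partial>count_space E)
        = (\<integral>\<^sup>+p. ennreal (w k) * indicator (E \<inter> square (2 ^ k)) p \<partial>count_space E)"
      by (intro nn_integral_cong) (auto simp: indicator_def)
    also have "\<dots> = ennreal (w k) * ennreal (real (card (E \<inter> square (2 ^ k))))"
      using finite_one_separated_square[OF E, of "2 ^ k"]
      by (subst nn_integral_cmult_indicator)
         (auto simp: emeasure_count_space ennreal_of_nat_eq_real_of_nat)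
    also have "\<dots> = ennreal (w k * real (card (E \<inter> square (2 ^ k))))"
      using w by (simp add: ennreal_mult)
    also have "\<dots> \<le> ennreal (w k * (C * (2 ^ k) powr b))"
      using w C(2)[of "2 ^ k"] by (intro ennreal_leI mult_left_mono) auto
    also have "w k * (C * (2 ^ k) powr b) = 2 powr s * C * ((2 ^ k) powr b * (2 ^ k) powr - s)"
      by (simp add: w_def)
    finally show ?thesis unfolding eq .
  qed
  have "(\<integral>\<^sup>+p. ennreal ((1 + supnorm p) powr - s) \<partial>count_space E)
      \<le> (\<integral>\<^sup>+p. (\<Sum>k. ennreal (w k) * indicator (square (2 ^ k)) p) \<partial>count_space E)"
    by (intro nn_integral_mono pointwise)
  also have "\<dots> = (\<Sum>k. \<integral>\<^sup>+p. ennreal (w k) * indicator (square (2 ^ k)) p \<partial>count_space E)"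
    by (intro nn_integral_suminf) auto
  also have "\<dots> \<le> (\<Sum>k. ennreal (2 powr s * C * (2 powr (b - s)) ^ k))"
    by (intro suminf_le term_le) auto
  also have "\<dots> < \<infinity>"
  proof -
    have "2 powr (b - s) < (1::real)" using s by (simp add: powr_less_one)
    then have "summable (\<lambda>k. 2 powr s * C * (2 powr (b - s)) ^ k)"
      by (intro summable_mult summable_geometric) auto
    then have "(\<Sum>k. ennreal (2 powr s * C * (2 powr (b - s)) ^ k)) \<noteq> top"
      using C(1) by (intro ennreal_suminf_neq_top) auto
    then show ?thesis by (simp only: less_top infinity_ennreal_def)
  qed
  finally show ?thesis .
qed

text \<open>A Markov-type estimate: for \<open>l \<ge> 1\<close> each point of
  \<open>square l\<close> has \<open>1 + supnorm p \<le> 2 * l\<close>, hence weight at least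
  \<open>(2 * l) powr - a\<close>, so a finite total bounds the count by a constant times
  \<open>(2 * l) powr a\<close>. The constant vanishes in the limit after division by
  \<open>ln (2 * l)\<close>.\<close>

lemma mass_dim_le_of_weight_finite:
  assumes E: "one_separated E" and a: "0 \<le> a"
    and fin: "(\<integral>\<^sup>+p. ennreal ((1 + supnorm p) powr - a) \<partial>count_space E) < \<infinity>"
  shows "mass_dim E \<le> ereal a"
proof -
  obtain S where S: "0 \<le> S" "(\<integral>\<^sup>+p. ennreal ((1 + supnorm p) powr - a) \<partial>count_space E) = ennreal S"
    using fin by (cases "\<integral>\<^sup>+p. ennreal ((1 + supnorm p) powr - a) \<partial>count_space E") auto
  have card_le: "real (card (E \<inter> square l)) \<le> (S + 1) * (2 * l) powr a" if l: "1 \<le> l" for l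
  proof -
    have "ennreal ((2 * l) powr - a * real (card (E \<inter> square l)))
        = ennreal ((2 * l) powr - a) * ennreal (real (card (E \<inter> square l)))"
      by (simp add: ennreal_mult)
    also have "\<dots> = (\<integral>\<^sup>+p. ennreal ((2 * l) powr - a) * indicator (E \<inter> square l) p \<partial>count_space E)"
      using finite_one_separated_square[OF E, of l]
      by (subst nn_integral_cmult_indicator)
         (auto simp: emeasure_count_space ennreal_of_nat_eq_real_of_nat)
    also have "\<dots> \<le> (\<integral>\<^sup>+p. ennreal ((1 + supnorm p) powr - a) \<partial>count_space E)"
    proof (intro nn_integral_mono)
      fix p
      have "(2 * l) powr - a \<le> (1 + supnorm p) powr - a" if "supnorm p \<le> l"
        using that l a supnorm_nonneg[of p] by (intro powr_mono2') auto
      then show "ennreal ((2 * l) powr - a) * indicator (E \<inter> square l) p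
          \<le> ennreal ((1 + supnorm p) powr - a)"
        by (auto simp: indicator_def mem_square_iff[of p] ennreal_leI)
    qed
    finally have "(2 * l) powr - a * real (card (E \<inter> square l)) \<le> S"
      using S by simp
    then have "real (card (E \<inter> square l)) \<le> S * (2 * l) powr a"
      using l by (simp add: powr_minus field_simps)
    \<comment> \<open>A visibly positive constant lets the logarithm of the product split
      below.\<close>
    also have "\<dots> \<le> (S + 1) * (2 * l) powr a" by (intro mult_right_mono) auto
    finally show ?thesis .
  qed
  have "\<forall>\<^sub>F l in at_top. log_card (E \<inter> square l) / ereal (ln (2 * l))
      \<le> ereal (a + ln (S + 1) / ln (2 * l))"
    using eventually_ge_at_top[of 1]
  proof eventually_elim
    case (elim l)
    let ?N = "card (E \<inter> square l)"
    have ln_pos: "ln (2 * l) > 0" using elim by simp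
    show ?case
    proof (cases "?N = 0")
      case True
      then show ?thesis using ln_pos by (simp add: log_card_def)
    next
      case False
      have "ln (real ?N) \<le> ln ((S + 1) * (2 * l) powr a)"
        using False card_le[OF elim] elim S(1) by (intro ln_mono) auto
      also have "\<dots> = ln (S + 1) + a * ln (2 * l)"
        using elim S(1) by (simp add: ln_mult ln_powr)
      finally show ?thesis
        using False ln_pos by (simp add: log_card_def field_simps)
    qed
  qed
  then have "mass_dim E \<le> Limsup at_top (\<lambda>l::real. ereal (a + ln (S + 1) / ln (2 * l)))"
    unfolding mass_dim_def by (rule Limsup_mono)
  also have "\<dots> = ereal a"
  proof (intro lim_imp_Limsup)
    have "filterlim (\<lambda>l::real. ln (2 * l)) at_top at_top"
      by (intro filterlim_compose[OF ln_at_top] filterlim_tendsto_pos_mult_at_top[OF tendsto_const])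
         (auto intro: filterlim_ident)
    then have "((\<lambda>l::real. ln (S + 1) / ln (2 * l)) \<longlongrightarrow> 0) at_top"
      by (intro tendsto_divide_0[OF tendsto_const] filterlim_at_top_imp_at_infinity)
    from tendsto_add[OF tendsto_const[of a] this]
    show "((\<lambda>l::real. ereal (a + ln (S + 1) / ln (2 * l))) \<longlongrightarrow> ereal a) at_top" by simp
  qed simp
  finally show ?thesis .
qed

section \<open>Measure of the parameters whose tubes contain a given point\<close>

text \<open>The quotient is the coordinate of the orthogonal projection of \<open>(x, y)\<close>
  onto the line of slope \<open>u\<close> through the origin. For fixed \<open>u\<close> the
  condition thus confines \<open>v\<close> to a half-open interval of length 1.\<close>

lemma mem_tube_iff:
  assumes "0 < u"
  shows "(x, y) \<in> tube u v \<longleftrightarrow>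
    v < (x + u * y) / sqrt (1 + u\<^sup>2) \<and> (x + u * y) / sqrt (1 + u\<^sup>2) \<le> v + 1"
proof -
  have "1 + 1 / u\<^sup>2 = (1 + u\<^sup>2) / u\<^sup>2" using assms by (simp add: field_simps)
  then have eq: "sqrt (1 + 1 / u\<^sup>2) = sqrt (1 + u\<^sup>2) / u"
    using assms by (simp add: real_sqrt_divide)
  have "0 < sqrt (1 + u\<^sup>2)" by (simp add: add_pos_nonneg)
  have lower: "- (1 / u) * x + v * (sqrt (1 + u\<^sup>2) / u) < y \<longleftrightarrow> v * sqrt (1 + u\<^sup>2) < x + u * y"
    using assms by (simp add: field_simps)
  have upper: "y \<le> - (1 / u) * x + (v + 1) * (sqrt (1 + u\<^sup>2) / u) \<longleftrightarrow> x + u * y \<le> (v + 1) * sqrt (1 + u\<^sup>2)"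
  proof -
    have "- (1 / u) * x + (v + 1) * (sqrt (1 + u\<^sup>2) / u) = ((v + 1) * sqrt (1 + u\<^sup>2) - x) / u"
      by (simp add: diff_divide_distrib)
    then show ?thesis using assms by (simp only: pos_le_divide_eq) (simp add: algebra_simps)
  qed
  show ?thesis
    unfolding tube_def mem_Collect_eq prod.case eq lower upper
    using \<open>0 < sqrt (1 + u\<^sup>2)\<close> by (simp only: pos_less_divide_eq pos_divide_le_eq)
qed

text \<open>The dual view: the point is fixed and the parameters vary. Truncation at
  \<open>K\<close> is essential, since every \<open>u > 0\<close> admits a unit interval of
  \<open>v\<close> and the full parameter set has infinite measure.\<close>

definition tubes_through :: "real \<times> real \<Rightarrow> real \<Rightarrow> (real \<times> real) set" where
  "tubes_through p K = {(u, v). 0 < u \<and> u \<le> K \<and> \<bar>v\<bar> \<le> K \<and> p \<in> tube u v}"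

lemma tubes_through_sets [measurable]: "tubes_through p K \<in> sets borel"
proof -
  obtain x y where p: "p = (x, y)" by (cases p)
  have "tubes_through p K = {z \<in> space borel. 0 < fst z \<and> fst z \<le> K \<and> \<bar>snd z\<bar> \<le> K \<and>
     snd z < (x + fst z * y) / sqrt (1 + (fst z)\<^sup>2) \<and> (x + fst z * y) / sqrt (1 + (fst z)\<^sup>2) \<le> snd z + 1}"
    by (auto simp: tubes_through_def p mem_tube_iff)
  also have "\<dots> \<in> sets borel"
    unfolding borel_prod[symmetric] by measurable
  finally show ?thesis .
qed

text \<open>By Fubini the measure is at most the length of the set \<open>U\<close> of slopes that
  admit some \<open>v\<close> in range. If \<open>\<bar>y\<bar> \<ge> 1\<close>, \<open>U\<close>
  lies in an interval of length \<open>2 * M / \<bar>y\<bar>\<close>, and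
  \<open>\<bar>y\<bar>\<close> is comparable to the norm of \<open>p\<close> unless \<open>U\<close>
  is empty. If \<open>\<bar>y\<bar> < 1\<close>, a nonempty \<open>U\<close> forces \<open>p\<close>
  into a bounded region, where the trivial length \<open>K\<close> is enough.\<close>

lemma emeasure_tubes_through_le:
  assumes K: "0 \<le> K"
  obtains C where "0 \<le> C" "\<And>p. emeasure lborel (tubes_through p K) \<le> ennreal (C / (1 + supnorm p))"
proof
  \<comment> \<open>The product of the bound \<open>K + 1\<close> on the projection coordinate and
    the bound \<open>1 + K\<close> on \<open>sqrt (1 + u\<^sup>2)\<close>.\<close>
  define M where "M = (K + 1) * (1 + K)"
  \<comment> \<open>The first factor dominates both lengths \<open>2 * M\<close> and
    \<open>K\<close>; the second bounds \<open>1 + supnorm p\<close> relative to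
    \<open>max 1 \<bar>y\<bar>\<close>.\<close>
  let ?C = "(2 * M + K) * (M + K + 2)"
  have M: "0 \<le> M" using K by (simp add: M_def)
  show "0 \<le> ?C" using K M by simp
  fix p :: "real \<times> real"
  obtain x y where p: "p = (x, y)" by (cases p)
  let ?f = "\<lambda>u. (x + u * y) / sqrt (1 + u\<^sup>2)"
  define U where "U = {u. 0 < u \<and> u \<le> K \<and> \<bar>x + u * y\<bar> \<le> M}"
  have U_sets [measurable]: "U \<in> sets borel" unfolding U_def by measurable
  \<comment> \<open>For fixed \<open>u\<close> the admissible \<open>v\<close> lie in a unit interval; it meets \<open>[-K, K]\<close> only if \<open>u \<in> U\<close>.\<close>
  have slice: "emeasure lborel (Pair u -` tubes_through p K) \<le> indicator U u" for u
  proof (cases "u \<in> U")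
    case True
    have "Pair u -` tubes_through p K \<subseteq> {?f u - 1..?f u}"
      using True by (auto simp: tubes_through_def p mem_tube_iff)
    then have "emeasure lborel (Pair u -` tubes_through p K) \<le> emeasure lborel {?f u - 1..?f u}"
      by (intro emeasure_mono) auto
    then show ?thesis using True by simp
  next
    case False
    have "Pair u -` tubes_through p K = {}"
    proof (rule ccontr)
      assume "Pair u -` tubes_through p K \<noteq> {}"
      then obtain v where v: "0 < u" "u \<le> K" "\<bar>v\<bar> \<le> K" "v < ?f u" "?f u \<le> v + 1"
        by (auto simp: tubes_through_def p mem_tube_iff)
      have s: "0 < sqrt (1 + u\<^sup>2)" by (simp add: add_pos_nonneg)
      have "1 + u\<^sup>2 \<le> (1 + K)\<^sup>2" using v by (simp add: power2_sum add_increasing2 power_mono)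
      then have "sqrt (1 + u\<^sup>2) \<le> 1 + K" using K by (simp add: real_le_lsqrt)
      moreover have "\<bar>?f u\<bar> \<le> K + 1" using v by linarith
      ultimately have "\<bar>?f u\<bar> * sqrt (1 + u\<^sup>2) \<le> M"
        unfolding M_def using s K by (intro mult_mono) auto
      then have "\<bar>x + u * y\<bar> \<le> M" using s by (simp add: abs_divide)
      then show False using False v by (auto simp: U_def)
    qed
    then show ?thesis by simp
  qed
  have U_le: "emeasure lborel U \<le> ennreal (?C / (1 + supnorm p))"
  proof (cases "U = {}")
    case True
    then show ?thesis by simp
  next
    case False
    \<comment> \<open>A single admissible slope already bounds \<open>\<bar>x\<bar>\<close> in terms
      of \<open>\<bar>y\<bar>\<close>.\<close>
    then obtain u0 where u0: "0 < u0" "u0 \<le> K" "\<bar>x + u0 * y\<bar> \<le> M" by (auto simp: U_def)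
    have "\<bar>u0 * y\<bar> \<le> K * \<bar>y\<bar>" using u0 by (simp add: abs_mult mult_right_mono)
    then have x: "\<bar>x\<bar> \<le> M + K * \<bar>y\<bar>" using u0 by linarith
    then have r: "supnorm p \<le> M + (K + 1) * \<bar>y\<bar>"
      using K M by (auto simp: supnorm_def p algebra_simps)
    have r0: "0 < 1 + supnorm p" using supnorm_nonneg[of p] by simp
    show ?thesis
    proof (cases "1 \<le> \<bar>y\<bar>")
      case True
      have "1 + M \<le> (1 + M) * \<bar>y\<bar>" using True M by simp
      then have r': "1 + supnorm p \<le> (M + K + 2) * \<bar>y\<bar>" using r by (simp add: algebra_simps)
      \<comment> \<open>The centre is the zero of \<open>x + u * y\<close> as a function of
        \<open>u\<close>.\<close>
      have "U \<subseteq> cball (- x / y) (M / \<bar>y\<bar>)"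
      proof
        fix u assume "u \<in> U"
        then have "\<bar>(- x / y - u) * y\<bar> \<le> M" using True by (auto simp: U_def algebra_simps)
        then show "u \<in> cball (- x / y) (M / \<bar>y\<bar>)"
          using True by (simp add: dist_real_def abs_mult pos_le_divide_eq)
      qed
      then have "emeasure lborel U \<le> emeasure lborel (cball (- x / y) (M / \<bar>y\<bar>))"
        by (intro emeasure_mono) auto
      also have "\<dots> = ennreal (2 * M / \<bar>y\<bar>)"
        using M by (simp add: cball_eq_atLeastAtMost)
      also have "\<dots> \<le> ennreal (?C / (1 + supnorm p))"
      proof (intro ennreal_leI)
        have "2 * M * (1 + supnorm p) \<le> (2 * M + K) * ((M + K + 2) * \<bar>y\<bar>)"
          using r' K M r0 by (intro mult_mono) auto
        then show "2 * M / \<bar>y\<bar> \<le> ?C / (1 + supnorm p)"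
          using True r0 by (simp add: field_simps)
      qed
      finally show ?thesis .
    next
      case False
      then have "(K + 1) * \<bar>y\<bar> \<le> (K + 1) * 1" using K by (intro mult_left_mono) auto
      then have r': "1 + supnorm p \<le> M + K + 2" using r by simp
      have "emeasure lborel U \<le> emeasure lborel {0..K}"
        by (intro emeasure_mono) (auto simp: U_def)
      also have "\<dots> = ennreal K" using K by simp
      also have "\<dots> \<le> ennreal (?C / (1 + supnorm p))"
      proof (intro ennreal_leI)
        have "K * (1 + supnorm p) \<le> ?C"
          using r' K M r0 by (intro mult_mono) auto
        then show "K \<le> ?C / (1 + supnorm p)"
          using r0 by (simp add: field_simps)
      qed
      finally show ?thesis .
    qed
  qed
  have "emeasure lborel (tubes_through p K) = emeasure (lborel \<Otimes>\<^sub>M lborel) (tubes_through p K)"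
    by (simp add: lborel_prod)
  also have "\<dots> = (\<integral>\<^sup>+u. emeasure lborel (Pair u -` tubes_through p K) \<partial>lborel)"
    by (rule lborel.emeasure_pair_measure_alt) (simp only: lborel_prod, simp)
  also have "\<dots> \<le> (\<integral>\<^sup>+u. indicator U u \<partial>lborel)"
    by (intro nn_integral_mono slice)
  also have "\<dots> = emeasure lborel U" by simp
  finally show "emeasure lborel (tubes_through p K) \<le> ennreal (?C / (1 + supnorm p))"
    using U_le by (rule order_trans)
qed

section \<open>Exchange of sum and integral\<close>

text \<open>Integrating over the parameters brings in the factor \<open>C / (1 + supnorm p)\<close>,
  which turns the exponent \<open>a\<close> of the weight into \<open>1 + a\<close>; that sum
  converges because \<open>mass_dim E < 1 + a\<close>.\<close>

lemma AE_mass_dim_tube_le: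
  assumes E: "one_separated E" and a: "0 \<le> a" and d: "mass_dim E < ereal (1 + a)" and K: "0 \<le> K"
  shows "AE (u, v) in lborel. 0 < u \<longrightarrow> u \<le> K \<longrightarrow> \<bar>v\<bar> \<le> K \<longrightarrow> mass_dim (E \<inter> tube u v) \<le> ereal a"
proof -
  obtain C where C: "0 \<le> C" "\<And>p. emeasure lborel (tubes_through p K) \<le> ennreal (C / (1 + supnorm p))"
    using emeasure_tubes_through_le[OF K] by metis
  \<comment> \<open>The summation lemma needs room between the growth exponent and
    \<open>1 + a\<close>. The maximum with 0 covers the value \<open>-\<infinity>\<close> taken at
    the empty set.\<close>
  obtain b where b: "0 \<le> b" "mass_dim E < ereal b" "b < 1 + a"
  proof -
    have "max 0 (mass_dim E) < ereal (1 + a)" using d a by (auto simp: max_def)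
    then obtain b where "max 0 (mass_dim E) < ereal b" "ereal b < ereal (1 + a)"
      using ereal_dense2 by blast
    then show thesis using that[of b] by auto
  qed
  let ?w = "\<lambda>p. ennreal ((1 + supnorm p) powr - a)"
  define g where "g z = (\<integral>\<^sup>+p. ?w p * indicator (tubes_through p K) z \<partial>count_space E)" for z
  have cE: "countable E" by (rule countable_one_separated[OF E])
  interpret cs: sigma_finite_measure "count_space E"
    by (rule sigma_finite_measure_count_space_countable[OF cE])
  have g_meas: "g \<in> borel_measurable lborel"
    unfolding g_def
  proof (rule cs.borel_measurable_nn_integral)
    show "(\<lambda>(z, p). ?w p * indicator (tubes_through p K) z) \<in> borel_measurable (lborel \<Otimes>\<^sub>M count_space E)"
      unfolding case_prod_beta
      \<comment> \<open>Joint measurability reduces to measurability in \<open>z\<close> for each of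
        the countably many points \<open>p\<close>.\<close>
      by (rule measurable_compose_countable'[where f = "\<lambda>p b. ?w p * indicator (tubes_through p K) (fst b)"
            and g = snd and I = E]) (simp_all add: cE)
  qed
  have "(\<integral>\<^sup>+z. g z \<partial>lborel) = (\<integral>\<^sup>+p. \<integral>\<^sup>+z. ?w p * indicator (tubes_through p K) z \<partial>lborel \<partial>count_space E)"
    unfolding g_def by (rule nn_integral_count_space_nn_integral[OF cE]) auto
  also have "\<dots> = (\<integral>\<^sup>+p. ?w p * emeasure lborel (tubes_through p K) \<partial>count_space E)"
    by (intro nn_integral_cong) (simp add: nn_integral_cmult_indicator)
  also have "\<dots> \<le> (\<integral>\<^sup>+p. ennreal C * ennreal ((1 + supnorm p) powr - (1 + a)) \<partial>count_space E)"
  proof (intro nn_integral_mono)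
    fix p
    have r0: "0 < 1 + supnorm p" using supnorm_nonneg[of p] by simp
    have "?w p * emeasure lborel (tubes_through p K) \<le> ?w p * ennreal (C / (1 + supnorm p))"
      by (intro mult_left_mono C) auto
    also have "\<dots> = ennreal ((1 + supnorm p) powr - a * (C / (1 + supnorm p)))"
      using C(1) r0 by (intro ennreal_mult[symmetric]) auto
    also have "(1 + supnorm p) powr - a * (C / (1 + supnorm p)) = C * (1 + supnorm p) powr - (1 + a)"
    proof -
      have "(1 + supnorm p) powr - (1 + a) = (1 + supnorm p) powr - a * (1 + supnorm p) powr - 1"
        by (simp only: powr_add[symmetric]) (simp add: algebra_simps)
      also have "(1 + supnorm p) powr - 1 = 1 / (1 + supnorm p)"
        using r0 by (rule powr_neg_one)
      finally show ?thesis by simp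
    qed
    finally show "?w p * emeasure lborel (tubes_through p K)
        \<le> ennreal C * ennreal ((1 + supnorm p) powr - (1 + a))"
      using C(1) by (simp add: ennreal_mult)
  qed
  also have "\<dots> = ennreal C * (\<integral>\<^sup>+p. ennreal ((1 + supnorm p) powr - (1 + a)) \<partial>count_space E)"
    by (intro nn_integral_cmult) auto
  also have "\<dots> < \<infinity>"
    using nn_integral_weight_finite[OF E b(2,1,3)] by (simp add: ennreal_mult_less_top)
  finally have "AE z in lborel. g z \<noteq> \<infinity>"
    by (intro nn_integral_PInf_AE g_meas) auto
  then show ?thesis
  proof eventually_elim
    case (elim z)
    obtain u v where z: "z = (u, v)" by (cases z)
    have "mass_dim (E \<inter> tube u v) \<le> ereal a" if uv: "0 < u" "u \<le> K" "\<bar>v\<bar> \<le> K"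
    proof (rule mass_dim_le_of_weight_finite[OF _ a])
      show "one_separated (E \<inter> tube u v)"
        using E unfolding one_separated_def by (rule pairwise_subset) auto
      have "(\<integral>\<^sup>+p. ?w p \<partial>count_space (E \<inter> tube u v)) = (\<integral>\<^sup>+p. ?w p * indicator (tube u v) p \<partial>count_space E)"
        by (subst (1 2) nn_integral_count_space_indicator)
           (auto intro!: nn_integral_cong simp: indicator_def)
      \<comment> \<open>Inside the truncated region, \<open>z\<close> lies in
        \<open>tubes_through p K\<close> exactly when \<open>p\<close> lies in the tube.\<close>
      also have "\<dots> = g z"
        using uv by (auto simp: g_def z tubes_through_def indicator_def intro!: nn_integral_cong)
      finally show "(\<integral>\<^sup>+p. ?w p \<partial>count_space (E \<inter> tube u v)) < \<infinity>"
        using elim by (simp add: less_top)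
    qed
    then show ?case by (simp add: z)
  qed
qed

section \<open>Exhaustion of the parameter space and passage to the limiting exponent\<close>

theorem theorem1p7:
  fixes E :: "(real \<times> real) set"
  assumes "one_separated E"
  shows "AE (u, v) in lebesgue_on ({0<..} \<times> UNIV).
           mass_dim (E \<inter> tube u v) \<le> max 0 (mass_dim E - 1)"
proof -
  let ?D = "max 0 (mass_dim E - 1)"
  \<comment> \<open>The slack \<open>1 / real (Suc m)\<close> supplies the strict inequality on
    \<open>mass_dim E\<close>. Integer indices keep the exceptional null sets countable in
    number.\<close>
  have bound: "AE z in lborel. 0 < fst z \<longrightarrow> fst z \<le> real n \<longrightarrow> \<bar>snd z\<bar> \<le> real n \<longrightarrow>
      mass_dim (E \<inter> tube (fst z) (snd z)) \<le> ?D + ereal (1 / real (Suc m))" for n m :: nat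
  proof (cases "?D = \<infinity>")
    case True
    then show ?thesis by simp
  next
    case False
    then obtain r where r: "?D = ereal r" "0 \<le> r"
      by (cases ?D) (auto simp: max_def split: if_splits)
    have "mass_dim E - 1 \<le> ereal r" using r(1) by (metis max.cobounded2)
    then have "mass_dim E \<le> ereal (1 + r)"
      by (cases "mass_dim E") (auto simp: one_ereal_def)
    also have "\<dots> < ereal (1 + (r + 1 / real (Suc m)))" by simp
    finally have "mass_dim E < ereal (1 + (r + 1 / real (Suc m)))" .
    from AE_mass_dim_tube_le[OF assms _ this, of "real n"] r show ?thesis
      by (simp add: case_prod_beta)
  qed
  have "AE z in lborel. \<forall>n m :: nat. 0 < fst z \<longrightarrow> fst z \<le> real n \<longrightarrow> \<bar>snd z\<bar> \<le> real n \<longrightarrow>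
      mass_dim (E \<inter> tube (fst z) (snd z)) \<le> ?D + ereal (1 / real (Suc m))"
    unfolding AE_all_countable using bound by blast
  then have "AE z in lborel. 0 < fst z \<longrightarrow> mass_dim (E \<inter> tube (fst z) (snd z)) \<le> ?D"
  proof eventually_elim
    case (elim z)
    obtain n :: nat where n: "max (fst z) \<bar>snd z\<bar> \<le> real n" using real_arch_simple by blast
    show ?case
    proof (rule impI, rule ereal_le_epsilon2)
      fix e :: real assume "0 < fst z" "0 < e"
      from \<open>0 < e\<close> obtain m where m: "1 / real (Suc m) < e" by (rule nat_approx_posE)
      have "mass_dim (E \<inter> tube (fst z) (snd z)) \<le> ?D + ereal (1 / real (Suc m))"
        using elim[rule_format, of n m] n \<open>0 < fst z\<close> by simp
      also have "\<dots> \<le> ?D + ereal e" using m by (intro add_left_mono) auto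
      finally show "mass_dim (E \<inter> tube (fst z) (snd z)) \<le> ?D + ereal e" .
    qed
  qed
  \<comment> \<open>Lebesgue measure is the completion of \<open>lborel\<close>, so the exceptional
    set remains null.\<close>
  then have "AE z in lebesgue. z \<in> {0<..} \<times> UNIV \<longrightarrow> mass_dim (E \<inter> tube (fst z) (snd z)) \<le> ?D"
    by (intro AE_completion) (auto simp: mem_Times_iff)
  moreover have "({0<..} \<times> UNIV :: (real \<times> real) set) \<inter> space lebesgue \<in> sets lebesgue"
    by (auto intro!: sets_completionI_sets borel_open open_Times)
  ultimately show ?thesis
    by (simp add: AE_restrict_space_iff case_prod_beta)
qed

end
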